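(* Let $n\ge 3$. Given an $n$-gon center function $f(V_1,\ldots,V_n)$ (in terms of vertices), it is possible to find an $n$-gon center function $g(d_{ij})$ in terms of lengths such that the geometric interpretations (if they exist) of the centers corresponding to $f$ and $g$ coincide for every $n$-gon in $\mathrm{dom}(f)\subset\mathcal P_n$. Conversely, given an $n$-gon center function $g(d_{ij})$ in terms of lengths, it is possible to find an $n$-gon center function $f(V_1,\ldots,V_n)$ in terms of vertices such that the geometric interpretations (if they exist) of the corresponding centers coincide for every $n$-gon in $\mathrm{dom}(f)\subset\mathcal P_n$.
   Context: An $n$-gon is identified with a tuple $(V_1,\ldots,V_n)$ of points of $\mathbb R^2$ (its labelled vertices), the edges being the segments $V_iV_{i+1}$ (indices mod $n$, taken in $\{1,\ldots,n\}$). The set of all $n$-gons is $\mathcal P_n\approx(\mathbb R^2)^n$; center functions may also be considered on a restricted domain, such as the non-degenerated or the convex $n$-gons; in that case the identities below are required for $n$-gons in the domain. Let $\rho,\sigma$ be the permutations of $\{1,\ldots,n\}$ (generating the dihedral group $D_n$) given by $\rho(i)=i+1\bmod n$, $\sigma(i)=2+n-i\bmod n$ (so $\sigma(1)=1$). Center function in terms of vertices: a real-valued function $f(V_1,\ldots,V_n)$ such that (1) $f(V_1,V_2,\ldots,V_n)=f(V_1,V_{\sigma(2)},\ldots,V_{\sigma(n)})$; (2) there is $k\in\mathbb N$ (with $0\in\mathbb N$) such that $f(tV_1,\ldots,tV_n)=t^kf(V_1,\ldots,V_n)$ for all $t\in\mathbb R_{\ge 0}$; (3) $f(T(V_1),\ldots,T(V_n))=f(V_1,\ldots,V_n)$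 for every rigid motion (isometry) $T$ of the plane. Its coordinate map is $\varphi_f(V_1,\ldots,V_n)=[f(V_1,\ldots,V_n):f(V_2,\ldots,V_n,V_1):\ldots:f(V_n,V_1,\ldots,V_{n-1})]\in P_{n-1}\mathbb R$ (undefined if all entries are zero). For an $n$-gon $(V_1,\ldots,V_n)$ let $d_{ij}=|V_i-V_j|$ ($i\ne j$); up to congruence the $n$-gon is identified with the $n(n-1)$-tuple $(d_{ij})_{i\neq j}$ (whose entries are subject to compatibility conditions). Center function in terms of lengths: a real-valued function $g(d_{ij})$ of the tuple of side and diagonal lengths such that (1') $g(d_{ij})=g(d_{\sigma(i),\sigma(j)})$; (2') there is $k\in\mathbb N$ such that $g(t\cdot d_{ij})=t^k\cdot g(d_{ij})$ for all $t\in\mathbb R_{\ge 0}$; where $(d_{ij})$ are the lengths of an $n$-gon. Here $d_{\sigma(i),\sigma(j)}$ denotes the tuple whose $(i,j)$ entry is $d_{\sigma(i)\sigma(j)}$. Its coordinate map is $\varphi_g(d_{ij})=[g(d_{ij}):g(d_{\rho(i),\rho(j)}):\ldots:g(d_{\rho^{n-1}(i),\rho^{n-1}(j)})]\in P_{n-1}\mathbb R$ (undefined if all entries are zero). Geometric interpretation of the center of $(V_1,\ldots,V_n)$, in either case: if the coordinate map gives $[t_1:\ldots:t_n]$, it is the point $\widetilde t_1V_1+\ldots+\widetilde t_nV_n$, where $(\widetilde t_1,\ldots,\widetilde t_n)$ is the representative of $[t_1:\ldots:t_n]$ with $\widetilde t_1+\ldots+\widetilde t_n=1$ (when it exists). 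*)

theory Defs
  imports "HOL-Analysis.Analysis"
begin

text \<open>The representative in \<open>{1..n}\<close> of the residue class of \<open>m\<close> modulo \<open>n\<close>.\<close>

definition label :: "nat \<Rightarrow> nat \<Rightarrow> nat" where
  "label n m = (if m mod n = 0 then n else m mod n)"

definition rho :: "nat \<Rightarrow> nat \<Rightarrow> nat" where
  "rho n i = label n (i + 1)"

definition sigma :: "nat \<Rightarrow> nat \<Rightarrow> nat" where
  "sigma n i = label n (2 + n - i)"

text \<open>Tuples are extensional functions, so that equality of tuples is equality of functions
  and a function of a polygon depends on \<open>V 1, \<dots>, V n\<close> only.\<close>

type_synonym polygon = "nat \<Rightarrow> real ^ 2"

definition ngons :: "nat \<Rightarrow> polygon set" where
  "ngons n = {1..n} \<rightarrow>\<^sub>E UNIV"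

definition relabel :: "nat \<Rightarrow> (nat \<Rightarrow> nat) \<Rightarrow> polygon \<Rightarrow> polygon" where
  "relabel n p V = (\<lambda>i\<in>{1..n}. V (p i))"

definition scale :: "nat \<Rightarrow> real \<Rightarrow> polygon \<Rightarrow> polygon" where
  "scale n t V = (\<lambda>i\<in>{1..n}. t *\<^sub>R V i)"

definition move :: "nat \<Rightarrow> (real ^ 2 \<Rightarrow> real ^ 2) \<Rightarrow> polygon \<Rightarrow> polygon" where
  "move n T V = (\<lambda>i\<in>{1..n}. T (V i))"

text \<open>Isometries of the plane, orientation-reversing ones included; surjectivity is automatic.\<close>

definition rigid_motion :: "(real ^ 2 \<Rightarrow> real ^ 2) \<Rightarrow> bool" where
  "rigid_motion T \<longleftrightarrow> (\<forall>x y. dist (T x) (T y) = dist x y)"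

type_synonym length_tuple = "nat \<times> nat \<Rightarrow> real"

definition label_pairs :: "nat \<Rightarrow> (nat \<times> nat) set" where
  "label_pairs n = {(i, j). i \<in> {1..n} \<and> j \<in> {1..n} \<and> i \<noteq> j}"

definition lengths :: "nat \<Rightarrow> polygon \<Rightarrow> length_tuple" where
  "lengths n V = (\<lambda>(i, j)\<in>label_pairs n. dist (V i) (V j))"

definition relabel_lengths :: "nat \<Rightarrow> (nat \<Rightarrow> nat) \<Rightarrow> length_tuple \<Rightarrow> length_tuple" where
  "relabel_lengths n p d = (\<lambda>(i, j)\<in>label_pairs n. d (p i, p j))"

definition scale_lengths :: "nat \<Rightarrow> real \<Rightarrow> length_tuple \<Rightarrow> length_tuple" where
  "scale_lengths n t d = (\<lambda>(i, j)\<in>label_pairs n. t * d (i, j))"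

text \<open>A center function is a total HOL function together with its domain; values outside the
  domain are irrelevant. The domain is closed under the operations occurring in the identities
  and in the coordinate map, so that these only involve values on the domain. The exception is
  scaling by \<open>0\<close>: it collapses a polygon to a point, which the domain may exclude
  (as for non-degenerate or convex polygons), hence the guard in the homogeneity condition.\<close>

definition polygon_domain :: "nat \<Rightarrow> polygon set \<Rightarrow> bool" where
  "polygon_domain n D \<longleftrightarrow>
     D \<subseteq> ngons n \<and>
     (\<forall>V\<in>D. relabel n (rho n) V \<in> D) \<and>
     (\<forall>V\<in>D. relabel n (sigma n) V \<in> D) \<and>
     (\<forall>V\<in>D. \<forall>t>0. scale n t V \<in> D) \<and>
     (\<forall>V\<in>D. \<forall>T. rigid_motion T \<longrightarrow> move n T V \<in> D)"

definition vertex_center_function :: "nat \<Rightarrow> polygon set \<Rightarrow> (polygon \<Rightarrow> real) \<Rightarrow> bool" where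
  "vertex_center_function n D f \<longleftrightarrow>
     polygon_domain n D \<and>
     (\<forall>V\<in>D. f V = f (relabel n (sigma n) V)) \<and>
     (\<exists>k::nat. \<forall>V\<in>D. \<forall>t\<ge>0. scale n t V \<in> D \<longrightarrow> f (scale n t V) = t ^ k * f V) \<and>
     (\<forall>V\<in>D. \<forall>T. rigid_motion T \<longrightarrow> f (move n T V) = f V)"

definition length_domain :: "nat \<Rightarrow> length_tuple set \<Rightarrow> bool" where
  "length_domain n E \<longleftrightarrow>
     E \<subseteq> lengths n ` ngons n \<and>
     (\<forall>d\<in>E. relabel_lengths n (rho n) d \<in> E) \<and>
     (\<forall>d\<in>E. relabel_lengths n (sigma n) d \<in> E) \<and>
     (\<forall>d\<in>E. \<forall>t>0. scale_lengths n t d \<in> E)"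

definition length_center_function ::
    "nat \<Rightarrow> length_tuple set \<Rightarrow> (length_tuple \<Rightarrow> real) \<Rightarrow> bool" where
  "length_center_function n E g \<longleftrightarrow>
     length_domain n E \<and>
     (\<forall>d\<in>E. g d = g (relabel_lengths n (sigma n) d)) \<and>
     (\<exists>k::nat. \<forall>d\<in>E. \<forall>t\<ge>0. scale_lengths n t d \<in> E \<longrightarrow>
        g (scale_lengths n t d) = t ^ k * g d)"

text \<open>The point \<open>[t 1 : \<dots> : t n]\<close> of projective space, as the set of its representatives;
  \<open>None\<close> if all entries are zero.\<close>

definition proj_point :: "nat \<Rightarrow> (nat \<Rightarrow> real) \<Rightarrow> (nat \<Rightarrow> real) set option" where
  "proj_point n t =
     (if \<forall>i\<in>{1..n}. t i = 0 then None
      else Some {(\<lambda>i\<in>{1..n}. c * t i) | c. c \<noteq> 0})"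

definition vertex_coordinates ::
    "nat \<Rightarrow> (polygon \<Rightarrow> real) \<Rightarrow> polygon \<Rightarrow> (nat \<Rightarrow> real) set option" where
  "vertex_coordinates n f V = proj_point n (\<lambda>i. f (relabel n (rho n ^^ (i - 1)) V))"

definition length_coordinates ::
    "nat \<Rightarrow> (length_tuple \<Rightarrow> real) \<Rightarrow> length_tuple \<Rightarrow> (nat \<Rightarrow> real) set option" where
  "length_coordinates n g d = proj_point n (\<lambda>i. g (relabel_lengths n (rho n ^^ (i - 1)) d))"

text \<open>The representative with sum \<open>1\<close> is unique if it exists; the result is \<open>None\<close> if it does
  not exist or if the coordinates are undefined.\<close>

definition geometric_interpretation ::
    "nat \<Rightarrow> polygon \<Rightarrow> (nat \<Rightarrow> real) set option \<Rightarrow> (real ^ 2) option" where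
  "geometric_interpretation n V P =
     (case P of
        None \<Rightarrow> None
      | Some Q \<Rightarrow>
          (if \<exists>s\<in>Q. (\<Sum>i=1..n. s i) = 1
           then Some (let s = (THE s. s \<in> Q \<and> (\<Sum>i=1..n. s i) = 1) in \<Sum>i=1..n. s i *\<^sub>R V i)
           else None))"

definition vertex_center :: "nat \<Rightarrow> (polygon \<Rightarrow> real) \<Rightarrow> polygon \<Rightarrow> (real ^ 2) option" where
  "vertex_center n f V = geometric_interpretation n V (vertex_coordinates n f V)"

definition length_center :: "nat \<Rightarrow> (length_tuple \<Rightarrow> real) \<Rightarrow> polygon \<Rightarrow> (real ^ 2) option" where
  "length_center n g V = geometric_interpretation n V (length_coordinates n g (lengths n V))"

end

theory Submission
  imports Defs
begin

text \<open>The pairwise distances determine a polygon up to a rigid motion, so a function of the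
  vertices that is invariant under rigid motions factors through the tuple of lengths; conversely
  a function of the lengths is composed with \<open>V \<mapsto> (d i j)\<close>. Under this correspondence the
  two coordinate maps agree entry by entry.

  The congruence of polygons with equal distances is obtained by matching one vertex at a time:
  the reflection exchanging the next vertex \<open>p\<close> with its target \<open>q\<close> fixes all vertices matched
  so far, because these are equidistant from \<open>p\<close> and \<open>q\<close>.\<close>

section \<open>Congruence of point families with equal distances\<close>

text \<open>The reflection in the perpendicular bisector of \<open>p\<close> and \<open>q\<close>.
  For \<open>p = q\<close> it is the identity.\<close>

definition bisector_reflection :: "'a::real_inner \<Rightarrow> 'a \<Rightarrow> 'a \<Rightarrow> 'a" where
  "bisector_reflection p q x =
     x - (2 * ((x - midpoint p q) \<bullet> (p - q)) / ((p - q) \<bullet> (p - q))) *\<^sub>R (p - q)"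

lemma dist_bisector_reflection:
  "dist (bisector_reflection p q x) (bisector_reflection p q y) = dist x y"
proof -
  \<comment> \<open>The linear part of the map is the Householder reflection along
    \<open>v = p - q\<close>.\<close>
  have norm: "norm (z - (2 * (z \<bullet> v) / (v \<bullet> v)) *\<^sub>R v) = norm z" for v z :: 'a
  proof (cases "v = 0")
    case False
    then have "v \<bullet> v \<noteq> 0" by simp
    then show ?thesis
      by (simp add: norm_eq inner_diff_left inner_diff_right inner_commute field_simps)
  qed simp
  have "bisector_reflection p q x - bisector_reflection p q y
      = (x - y) - (2 * ((x - y) \<bullet> (p - q)) / ((p - q) \<bullet> (p - q))) *\<^sub>R (p - q)"
    by (simp add: bisector_reflection_def inner_diff_left diff_divide_distrib
        scaleR_left.diff right_diff_distrib)
  then show ?thesis by (simp only: dist_norm norm)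
qed

lemma bisector_reflection_swap: "bisector_reflection p q p = q"
proof (cases "p = q")
  case False
  \<comment> \<open>At \<open>x = p\<close> this makes the coefficient of \<open>p - q\<close> equal
    to 1.\<close>
  have half: "p - midpoint p q = (1/2) *\<^sub>R (p - q)"
    by (rule scaleR_left_imp_eq[of 2])
      (simp_all add: midpoint_def scaleR_right_diff_distrib scaleR_2)
  show ?thesis
    using False unfolding bisector_reflection_def half by simp
qed (simp add: bisector_reflection_def)

text \<open>Equidistance makes \<open>x - midpoint p q\<close> orthogonal to \<open>p - q\<close>,
  so the correction term vanishes.\<close>

lemma bisector_reflection_fixed:
  assumes "dist x p = dist x q"
  shows "bisector_reflection p q x = x"
proof -
  have "(x - p) \<bullet> (x - p) = (x - q) \<bullet> (x - q)"
    using assms by (simp add: dist_norm norm_eq)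
  then have "(x - midpoint p q) \<bullet> (p - q) = 0"
    by (simp add: midpoint_def inner_diff_left inner_diff_right inner_add_left inner_commute
        algebra_simps)
  then show ?thesis by (simp add: bisector_reflection_def)
qed

lemma congruent_if_equal_dists:
  fixes V W :: "'i \<Rightarrow> 'a::real_inner"
  assumes "finite I" "\<And>i j. i \<in> I \<Longrightarrow> j \<in> I \<Longrightarrow> dist (V i) (V j) = dist (W i) (W j)"
  shows "\<exists>T. (\<forall>x y. dist (T x) (T y) = dist x y) \<and> (\<forall>i\<in>I. T (V i) = W i)"
  using assms
proof (induction I)
  case empty
  show ?case by (rule exI[of _ "\<lambda>x. x"]) simp
next
  case (insert k I)
  from insert.IH insert.prems obtain T
    where T: "\<And>x y. dist (T x) (T y) = dist x y" "\<And>i. i \<in> I \<Longrightarrow> T (V i) = W i"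
    by (metis insert_iff)
  \<comment> \<open>As \<open>T\<close> preserves distances, \<open>W i = T (V i)\<close> is as far
    from \<open>T (V k)\<close> as \<open>V i\<close> is from \<open>V k\<close>, hence as
    \<open>W i\<close> is from \<open>W k\<close>.\<close>
  have "bisector_reflection (T (V k)) (W k) (W i) = W i" if "i \<in> I" for i
    using insert.prems[of i k] T(1)[of "V i" "V k"] T(2)[OF that] that
    by (intro bisector_reflection_fixed) simp
  with T show ?case
    by (intro exI[of _ "\<lambda>x. bisector_reflection (T (V k)) (W k) (T x)"])
      (auto simp: dist_bisector_reflection bisector_reflection_swap)
qed

section \<open>The operations on polygons and on length tuples\<close>

lemma lengths_eq_imp_move:
  assumes "V \<in> ngons n" "W \<in> ngons n" "lengths n V = lengths n W"
  obtains T where "rigid_motion T" "move n T V = W"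
proof -
  have dists: "dist (V i) (V j) = dist (W i) (W j)" if "i \<in> {1..n}" "j \<in> {1..n}" for i j
  proof (cases "i = j")
    case False
    with that have "(i, j) \<in> label_pairs n" by (simp add: label_pairs_def)
    with fun_cong[OF assms(3), of "(i, j)"] show ?thesis by (simp add: lengths_def)
  qed simp
  have "\<exists>T. rigid_motion T \<and> (\<forall>i\<in>{1..n}. T (V i) = W i)"
    unfolding rigid_motion_def
    by (rule congruent_if_equal_dists[OF finite_atLeastAtMost]) (fact dists)
  then obtain T where T: "rigid_motion T" "\<forall>i\<in>{1..n}. T (V i) = W i"
    by blast
  \<comment> \<open>Extensionality turns agreement on the labels into equality of functions.\<close>
  from assms(2) have "W i = undefined" if "i \<notin> {1..n}" for i
    using that unfolding ngons_def by (rule PiE_arb)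
  with T(2) have "move n T V = W" by (simp add: move_def restrict_def fun_eq_iff)
  with T(1) show thesis by (rule that)
qed

lemma lengths_move: "rigid_motion T \<Longrightarrow> lengths n (move n T V) = lengths n V"
  by (auto simp: lengths_def move_def label_pairs_def rigid_motion_def fun_eq_iff)

lemma lengths_scale: "t \<ge> 0 \<Longrightarrow> lengths n (scale n t V) = scale_lengths n t (lengths n V)"
  by (auto simp: lengths_def scale_def scale_lengths_def label_pairs_def fun_eq_iff dist_norm
      simp flip: scaleR_diff_right)

text \<open>Injectivity of \<open>p\<close> keeps pairs off the diagonal, where
  \<open>lengths n V\<close> holds actual distances instead of \<open>undefined\<close>.\<close>

lemma lengths_relabel:
  assumes "bij_betw p {1..n} {1..n}"
  shows "lengths n (relabel n p V) = relabel_lengths n p (lengths n V)"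
proof -
  have "(p i, p j) \<in> label_pairs n" if "(i, j) \<in> label_pairs n" for i j
    using that bij_betw_apply[OF assms] inj_onD[OF bij_betw_imp_inj_on[OF assms], of i j]
    by (auto simp only: label_pairs_def mem_Collect_eq case_prod_conv)
  moreover have "i \<in> {1..n}" "j \<in> {1..n}" if "(i, j) \<in> label_pairs n" for i j
    using that by (simp_all add: label_pairs_def)
  ultimately show ?thesis
    by (simp add: lengths_def relabel_def relabel_lengths_def fun_eq_iff restrict_def
        del: atLeastAtMost_iff)
qed

lemma relabel_in_ngons: "relabel n p V \<in> ngons n"
  and scale_in_ngons: "scale n t V \<in> ngons n"
  and move_in_ngons: "move n T V \<in> ngons n"
  by (simp_all add: relabel_def scale_def move_def ngons_def)

lemma label_id: "m \<in> {1..n} \<Longrightarrow> label n m = m"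
  by (cases "m = n") (auto simp: label_def)

lemma label_add_self: "label n (m + n) = label n m"
  by (simp add: label_def)

lemma bij_betw_rho: "bij_betw (rho n) {1..n} {1..n}"
proof -
  have rho: "rho n i = (if i = n then 1 else i + 1)" if "i \<in> {1..n}" for i
    using that label_add_self[of n 1] by (auto simp: rho_def label_id)
  have "inj_on (rho n) {1..n}" "rho n ` {1..n} \<subseteq> {1..n}"
    by (auto simp: inj_on_def rho split: if_splits)
  then show ?thesis by (simp add: bij_betw_def endo_inj_surj)
qed

lemma bij_betw_sigma: "bij_betw (sigma n) {1..n} {1..n}"
proof -
  have sigma: "sigma n i = (if i = 1 then 1 else 2 + n - i)" if "i \<in> {1..n}" for i
  proof (cases "i = 1")
    case True
    \<comment> \<open>Here \<open>2 + n - 1 = n + 1\<close> exceeds the label range and wraps around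
      to 1.\<close>
    with that label_add_self[of n 1] show ?thesis by (simp add: sigma_def label_id)
  next
    case False
    with that have "2 + n - i \<in> {1..n}" by auto
    with False show ?thesis by (simp only: sigma_def label_id if_False)
  qed
  have "inj_on (sigma n) {1..n}" "sigma n ` {1..n} \<subseteq> {1..n}"
    by (auto simp: inj_on_def sigma split: if_splits)
  then show ?thesis by (simp add: bij_betw_def endo_inj_surj)
qed

text \<open>The coordinate map evaluates \<open>f\<close> at these cyclic relabellings, so the
  domain must contain them.\<close>

lemma relabel_funpow_rho_in:
  assumes "polygon_domain n D" "V \<in> D"
  shows "relabel n (rho n ^^ m) V \<in> D"
proof (induction m)
  case 0
  from assms have "V \<in> {1..n} \<rightarrow>\<^sub>E UNIV"
    by (auto simp: polygon_domain_def ngons_def)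
  from PiE_arb[OF this] have "relabel n (rho n ^^ 0) V = V"
    by (auto simp: relabel_def fun_eq_iff)
  with assms(2) show ?case by (simp only:)
next
  case (Suc m)
  \<comment> \<open>Relabelling composes in reverse order, which is harmless for powers of a single
    map.\<close>
  have "relabel n (rho n ^^ Suc m) V = relabel n (rho n) (relabel n (rho n ^^ m) V)"
    using bij_betw_apply[OF bij_betw_rho, of _ n]
    by (auto simp: relabel_def fun_eq_iff funpow_swap1)
  with Suc assms(1) show ?case by (simp only: polygon_domain_def)
qed

section \<open>Passing between vertices and lengths\<close>

text \<open>The equality is one of options: either center exists exactly when the other
  does.\<close>

lemma vertex_center_eq_length_center:
  assumes "polygon_domain n D" "V \<in> D" "\<And>W. W \<in> D \<Longrightarrow> f W = g (lengths n W)"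
  shows "vertex_center n f V = length_center n g V"
  using assms(3)[OF relabel_funpow_rho_in[OF assms(1,2)]]
  by (simp add: vertex_center_def length_center_def vertex_coordinates_def length_coordinates_def
      lengths_relabel[OF bij_betw_funpow[OF bij_betw_rho]])

lemma length_domain_image:
  assumes "polygon_domain n D"
  shows "length_domain n (lengths n ` D)"
  using assms unfolding length_domain_def polygon_domain_def
  by (auto simp flip: lengths_relabel[OF bij_betw_rho] lengths_relabel[OF bij_betw_sigma]
      lengths_scale)

text \<open>Closure under rigid motions comes from the invariance of \<open>lengths\<close>; the
  other closures are pulled back from \<open>E\<close>.\<close>

lemma polygon_domain_vimage:
  assumes "length_domain n E"
  shows "polygon_domain n {V \<in> ngons n. lengths n V \<in> E}"
  using assms unfolding length_domain_def polygon_domain_def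
  by (auto simp: relabel_in_ngons scale_in_ngons move_in_ngons lengths_move lengths_scale
      lengths_relabel[OF bij_betw_rho] lengths_relabel[OF bij_betw_sigma])

lemma length_center_function_if_vertex:
  assumes f: "vertex_center_function n D f" and g: "\<And>V. V \<in> D \<Longrightarrow> f V = g (lengths n V)"
  shows "length_center_function n (lengths n ` D) g"
proof -
  from f have D: "polygon_domain n D" by (simp add: vertex_center_function_def)
  from f obtain k where k: "\<And>V t. V \<in> D \<Longrightarrow> t \<ge> 0 \<Longrightarrow> scale n t V \<in> D \<Longrightarrow>
      f (scale n t V) = t ^ k * f V"
    unfolding vertex_center_function_def by blast
  have "g (relabel_lengths n (sigma n) (lengths n V)) = g (lengths n V)" if "V \<in> D" for V
    using f that D g[of V] g[of "relabel n (sigma n) V"]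
    by (simp add: vertex_center_function_def polygon_domain_def lengths_relabel[OF bij_betw_sigma])
  moreover have "g (scale_lengths n t (lengths n V)) = t ^ k * g (lengths n V)"
    if "V \<in> D" "t \<ge> 0" "scale_lengths n t (lengths n V) \<in> lengths n ` D" for V t
  proof -
    \<comment> \<open>For \<open>t = 0\<close>, closure of \<open>D\<close> under positive scaling does not help; the polygon of \<open>D\<close>
      having these lengths does.\<close>
    from that obtain W where W: "W \<in> D" "lengths n W = lengths n (scale n t V)"
      by (auto simp: lengths_scale)
    with D have "W \<in> ngons n" by (auto simp: polygon_domain_def)
    then obtain T where "rigid_motion T" "move n T W = scale n t V"
      using W(2) scale_in_ngons lengths_eq_imp_move by metis
    with W(1) D have "scale n t V \<in> D" by (metis polygon_domain_def)
    with k[OF that(1,2)] g that show ?thesis by (simp flip: lengths_scale)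
  qed
  ultimately show ?thesis
    using length_domain_image[OF D] unfolding length_center_function_def by auto
qed

lemma vertex_center_function_if_length:
  assumes g: "length_center_function n E g"
  shows "vertex_center_function n {V \<in> ngons n. lengths n V \<in> E} (\<lambda>V. g (lengths n V))"
proof -
  from g obtain k where "\<forall>d\<in>E. \<forall>t\<ge>0. scale_lengths n t d \<in> E \<longrightarrow>
      g (scale_lengths n t d) = t ^ k * g d"
    unfolding length_center_function_def by blast
  then show ?thesis
    using g polygon_domain_vimage
    unfolding vertex_center_function_def length_center_function_def
    by (auto simp: lengths_move lengths_scale lengths_relabel[OF bij_betw_sigma] intro!: exI[of _ k])
qed

lemma vertex_function_factors_through_lengths:
  assumes f: "vertex_center_function n D f"
  shows "\<exists>g. \<forall>V\<in>D. f V = g (lengths n V)"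
proof (intro exI ballI)
  fix V assume V: "V \<in> D"
  \<comment> \<open>The witness evaluates \<open>f\<close> at a chosen polygon \<open>W\<close> of
    \<open>D\<close> with the given lengths. It may differ from \<open>V\<close>, but only by a
    rigid motion, under which \<open>f\<close> is invariant.\<close>
  define W where "W = inv_into D (lengths n) (lengths n V)"
  have W: "W \<in> D" "lengths n W = lengths n V"
    using V by (auto simp: W_def inv_into_into f_inv_into_f)
  have "D \<subseteq> ngons n"
    using f by (simp add: vertex_center_function_def polygon_domain_def)
  then obtain T where "rigid_motion T" "move n T W = V"
    using V W lengths_eq_imp_move by blast
  then have "f V = f W"
    using f W(1) unfolding vertex_center_function_def by blast
  then show "f V = (f \<circ> inv_into D (lengths n)) (lengths n V)"
    by (simp add: W_def)
qed

theorem theorem13: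
  fixes n :: nat
  assumes "n \<ge> 3"
  shows "(\<forall>D f. vertex_center_function n D f \<longrightarrow>
            (\<exists>g. length_center_function n (lengths n ` D) g \<and>
                 (\<forall>V\<in>D. vertex_center n f V = length_center n g V)))
       \<and> (\<forall>E g. length_center_function n E g \<longrightarrow>
            (\<exists>f. vertex_center_function n {V \<in> ngons n. lengths n V \<in> E} f \<and>
                 (\<forall>V \<in> {V \<in> ngons n. lengths n V \<in> E}.
                    vertex_center n f V = length_center n g V)))"
proof (intro conjI allI impI)
  fix D f
  assume f: "vertex_center_function n D f"
  then have D: "polygon_domain n D" by (simp add: vertex_center_function_def)
  obtain g where g: "\<And>V. V \<in> D \<Longrightarrow> f V = g (lengths n V)"
    using vertex_function_factors_through_lengths[OF f] by blast
  show "\<exists>g. length_center_function n (lengths n ` D) g \<and>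
      (\<forall>V\<in>D. vertex_center n f V = length_center n g V)"
    using length_center_function_if_vertex[of n D f g, OF f g]
      vertex_center_eq_length_center[of n D _ f g, OF D _ g] by blast
next
  fix E g
  assume g: "length_center_function n E g"
  let ?D = "{V \<in> ngons n. lengths n V \<in> E}" and ?f = "\<lambda>V. g (lengths n V)"
  have f: "vertex_center_function n ?D ?f"
    using g by (rule vertex_center_function_if_length)
  then have "polygon_domain n ?D" by (simp add: vertex_center_function_def)
  with f show "\<exists>f. vertex_center_function n ?D f \<and>
      (\<forall>V\<in>?D. vertex_center n f V = length_center n g V)"
    using vertex_center_eq_length_center[of n ?D _ ?f g] by blast
qed

end
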